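(* For every $n\ge 1$, the Houghton group $H_n$ is finitely discriminable.
   Context: Let $\mathbf{N}$ denote the set of positive integers and, for $n\ge 1$, let $S=\mathbf{N}\times\{1,\dots,n\}$. The Houghton group $H_n$ is the group of all permutations $g$ of $S$ for which there is an $n$-tuple $(m_1,\dots,m_n)\in\mathbf{Z}^n$ such that for each $i\in\{1,\dots,n\}$ one has $g(x,i)=(x+m_i,i)$ for all sufficiently large $x\in\mathbf{N}$. A group $G$ is finitely discriminable if there exists a finite subset $F\subset G-\{1\}$ such that every non-trivial normal subgroup of $G$ contains at least one element of $F$. *)

theory Defs
  imports "HOL-Algebra.Algebra"
begin

definition rays :: "nat \<Rightarrow> (nat \<times> nat) set"
  where "rays n = {1..} \<times> {1..n}"

text \<open>
  As in \<^const>\<open>BijGroup\<close>, a permutation of a set \<open>S\<close> is a function of \<^term>\<open>Bij S\<close>: it restricts to a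
  bijection of \<open>S\<close> and is \<^const>\<open>undefined\<close> outside \<open>S\<close>. The product is composition.
\<close>

definition houghton_group :: "nat \<Rightarrow> (nat \<times> nat \<Rightarrow> nat \<times> nat) monoid"
  where "houghton_group n =
    (BijGroup (rays n)) \<lparr>carrier :=
      {g \<in> Bij (rays n). \<exists>m :: nat \<Rightarrow> int. \<forall>i\<in>{1..n}. \<forall>\<^sub>F x in sequentially.
         int (fst (g (x, i))) = int x + m i \<and> snd (g (x, i)) = i}\<rparr>"

text \<open>
  The conjunct \<^term>\<open>group G\<close> is needed: \<open>N \<lhd> G\<close> presupposes it, so the last conjunct alone would hold
  vacuously for a structure that is not a group.
\<close>

definition finitely_discriminable :: "('a, 'b) monoid_scheme \<Rightarrow> bool"
  where "finitely_discriminable G \<longleftrightarrow> group G \<and>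
    (\<exists>F. finite F \<and> F \<subseteq> carrier G - {\<one>\<^bsub>G\<^esub>} \<and>
         (\<forall>N. N \<lhd> G \<and> N \<noteq> {\<one>\<^bsub>G\<^esub>} \<longrightarrow> N \<inter> F \<noteq> {}))"

end

theory Submission
  imports Defs
begin

text \<open>
  The argument uses only that \<open>H\<^sub>n\<close> contains every transposition of the infinite set on which it acts.
  Let \<open>N\<close> be a normal subgroup of such a permutation group and let \<open>g \<in> N\<close> move a point \<open>a\<close>.
  For any point \<open>c\<close>, the commutator of \<open>g\<close> with the transposition \<open>(a c)\<close> lies in \<open>N\<close>, and it equals
  \<open>(g a  g c) (a c)\<close>, because conjugation by \<open>g\<close> relabels the points. If \<open>c\<close> avoids
  \<open>a\<close>, \<open>g a\<close> and the preimage of \<open>a\<close>, this commutator is a 3-cycle when \<open>g\<close> fixes \<open>c\<close>, and a product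
  of two disjoint transpositions otherwise. Products of transpositions also make the group
  transitive on tuples of distinct points of each given length, so all 3-cycles are conjugate in it,
  and so are all double transpositions. Hence one fixed 3-cycle and one fixed double transposition
  form a set that meets every non-trivial normal subgroup.

  What is special to \<open>H\<^sub>n\<close> is then only that it is a group, since the translation lengths add under
  composition, and that it contains the transpositions, since these have translation lengths \<open>0\<close>.
\<close>

section \<open>Permutation groups that contain the transpositions\<close>

lemma (in group) conjugate_mult:
  assumes h: "h \<in> carrier G" and x: "x \<in> carrier G" and y: "y \<in> carrier G"
  shows "h \<otimes> (x \<otimes> y) \<otimes> inv h = (h \<otimes> x \<otimes> inv h) \<otimes> (h \<otimes> y \<otimes> inv h)"
proof -
  have "inv h \<otimes> (h \<otimes> z) = z" if "z \<in> carrier G" for z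
    using h that by (simp add: m_assoc[symmetric])
  then show ?thesis using h x y by (simp add: m_assoc)
qed

locale group_with_transpositions =
  fixes S :: "'a set" and H :: "('a \<Rightarrow> 'a) set"
  assumes subgroup: "subgroup H (BijGroup S)"
    and transpose_in: "\<And>a b. a \<in> S \<Longrightarrow> b \<in> S \<Longrightarrow> restrict (transpose a b) S \<in> H"
begin

abbreviation G where "G \<equiv> BijGroup S\<lparr>carrier := H\<rparr>"

abbreviation tr where "tr a b \<equiv> restrict (transpose a b) S"

lemma group_G: "group G"
  using subgroup.subgroup_is_group[OF subgroup group_BijGroup] .

lemma one_G: "\<one>\<^bsub>G\<^esub> = (\<lambda>x\<in>S. x)"
  by (simp add: BijGroup_def)

lemma in_Bij: "g \<in> H \<Longrightarrow> g \<in> Bij S"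
  using subgroup.subset[OF subgroup] by (auto simp: BijGroup_def)

lemma inj_on_S: "g \<in> H \<Longrightarrow> inj_on g S"
  using in_Bij by (force simp: Bij_def bij_betw_def)

lemma maps_S: "g \<in> H \<Longrightarrow> x \<in> S \<Longrightarrow> g x \<in> S"
  using in_Bij by (force simp: Bij_def bij_betw_def)

lemma surj_on_S: "g \<in> H \<Longrightarrow> y \<in> S \<Longrightarrow> \<exists>x\<in>S. g x = y"
  using in_Bij by (force simp: Bij_def bij_betw_def)

lemma mult_G: "g \<in> H \<Longrightarrow> h \<in> H \<Longrightarrow> g \<otimes>\<^bsub>BijGroup S\<^esub> h = compose S g h"
  using in_Bij by (simp add: BijGroup_def)

lemma tr_square:
  assumes "a \<in> S" "b \<in> S"
  shows "tr a b \<otimes>\<^bsub>G\<^esub> tr a b = \<one>\<^bsub>G\<^esub>"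
  using assms by (auto simp: mult_G transpose_in one_G compose_def transpose_def fun_eq_iff)

lemma inv_tr:
  assumes "a \<in> S" "b \<in> S"
  shows "inv\<^bsub>G\<^esub> (tr a b) = tr a b"
  using group.inv_equality[OF group_G tr_square[OF assms]] assms transpose_in by simp

lemma conjugate_tr:
  assumes "g \<in> H" "a \<in> S" "b \<in> S"
  shows "g \<otimes>\<^bsub>G\<^esub> tr a b \<otimes>\<^bsub>G\<^esub> inv\<^bsub>G\<^esub> g = tr (g a) (g b)"
proof -
  interpret group G by (rule group_G)
  have in_H: "tr a b \<in> H" "tr (g a) (g b) \<in> H"
    using assms by (auto intro: transpose_in maps_S)
  have "g (transpose a b x) = transpose (g a) (g b) (g x)" if "x \<in> S" for x
    using inj_on_S[OF assms(1)] assms(2,3) that by (auto simp: transpose_def inj_on_def)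
  then have "g \<otimes>\<^bsub>G\<^esub> tr a b = tr (g a) (g b) \<otimes>\<^bsub>G\<^esub> g"
    using assms in_H by (auto simp: mult_G compose_def maps_S fun_eq_iff)
  moreover have "g \<in> carrier G" "tr (g a) (g b) \<in> carrier G"
    using assms(1) in_H by auto
  ultimately show ?thesis
    by (simp only: m_assoc r_inv r_one inv_closed)
qed

lemma conjugate_tr_product:
  assumes h: "h \<in> H" and pts: "a \<in> S" "b \<in> S" "c \<in> S" "d \<in> S"
  shows "h \<otimes>\<^bsub>G\<^esub> (tr a b \<otimes>\<^bsub>G\<^esub> tr c d) \<otimes>\<^bsub>G\<^esub> inv\<^bsub>G\<^esub> h
    = tr (h a) (h b) \<otimes>\<^bsub>G\<^esub> tr (h c) (h d)"
proof -
  interpret group G by (rule group_G)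
  have "h \<in> carrier G" "tr a b \<in> carrier G" "tr c d \<in> carrier G"
    using h pts transpose_in by auto
  then have "h \<otimes>\<^bsub>G\<^esub> (tr a b \<otimes>\<^bsub>G\<^esub> tr c d) \<otimes>\<^bsub>G\<^esub> inv\<^bsub>G\<^esub> h
    = (h \<otimes>\<^bsub>G\<^esub> tr a b \<otimes>\<^bsub>G\<^esub> inv\<^bsub>G\<^esub> h) \<otimes>\<^bsub>G\<^esub> (h \<otimes>\<^bsub>G\<^esub> tr c d \<otimes>\<^bsub>G\<^esub> inv\<^bsub>G\<^esub> h)"
    by (rule conjugate_mult)
  then show ?thesis
    using h pts by (simp only: conjugate_tr)
qed

text \<open>
  The permutation is built one point at a time: if \<open>h\<close> is already right on the tail, follow it by the
  transposition of \<open>h x\<close> and \<open>y\<close>. This leaves the tail of the target fixed, since it contains neither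
  \<open>y\<close> nor, by injectivity of \<open>h\<close>, the point \<open>h x\<close>.
\<close>
lemma transitive_on_distinct_lists:
  assumes "length xs = length ys" "distinct xs" "distinct ys" "set xs \<subseteq> S" "set ys \<subseteq> S"
  shows "\<exists>h\<in>H. map h xs = ys"
  using assms
proof (induction xs ys rule: list_induct2)
  case Nil
  then show ?case using subgroup.one_closed[OF subgroup] by auto
next
  case (Cons x xs y ys)
  then obtain h where h: "h \<in> H" and ys: "map h xs = ys" by auto
  have in_S: "x \<in> S" "y \<in> S" "h x \<in> S" "set xs \<subseteq> S"
    using Cons.prems h by (auto intro: maps_S)
  define k where "k = tr (h x) y \<otimes>\<^bsub>G\<^esub> h"
  have "k \<in> H"
    using monoid.m_closed[OF group.is_monoid[OF group_G], of "tr (h x) y" h] h in_S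
    by (simp add: k_def transpose_in)
  have k: "k z = transpose (h x) y (h z)" if "z \<in> S" for z
    using that h in_S by (simp add: k_def mult_G transpose_in compose_def maps_S)
  have "k z = h z" if "z \<in> set xs" for z
  proof -
    have "h z \<noteq> h x"
      using inj_onD[OF inj_on_S[OF h], of z x] that in_S Cons.prems by auto
    moreover have "h z \<noteq> y"
      using that ys Cons.prems by auto
    ultimately show ?thesis
      using that in_S k by auto
  qed
  then have "map k (x # xs) = y # ys"
    using k in_S ys by auto
  then show ?case using \<open>k \<in> H\<close> by (rule bexI)
qed

section \<open>Two conjugacy classes that meet every normal subgroup\<close>

text \<open>
  In the commutator \<open>g (a c) g\<^sup>-\<^sup>1 (a c)\<^sup>-\<^sup>1\<close> the last three factors form a conjugate of \<open>g\<^sup>-\<^sup>1\<close>, so the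
  commutator belongs to \<open>N\<close>; the first three form a conjugate of \<open>(a c)\<close>.
\<close>
lemma commutator_with_tr:
  assumes "N \<lhd> G" "g \<in> N" "a \<in> S" "c \<in> S"
  shows "tr (g a) (g c) \<otimes>\<^bsub>G\<^esub> tr a c \<in> N"
proof -
  interpret group G by (rule group_G)
  have N: "subgroup N G" using assms(1) by (rule normal_imp_subgroup)
  have g: "g \<in> carrier G" using subgroup.mem_carrier[OF N assms(2)] .
  have t: "tr a c \<in> carrier G" using assms by (simp add: transpose_in)
  have "tr a c \<otimes>\<^bsub>G\<^esub> inv\<^bsub>G\<^esub> g \<otimes>\<^bsub>G\<^esub> inv\<^bsub>G\<^esub> (tr a c) \<in> N"
    using normal.inv_op_closed2[OF assms(1) t subgroup.m_inv_closed[OF N assms(2)]] .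
  then have "g \<otimes>\<^bsub>G\<^esub> (tr a c \<otimes>\<^bsub>G\<^esub> inv\<^bsub>G\<^esub> g \<otimes>\<^bsub>G\<^esub> inv\<^bsub>G\<^esub> (tr a c)) \<in> N"
    by (rule subgroup.m_closed[OF N assms(2)])
  also have "g \<otimes>\<^bsub>G\<^esub> (tr a c \<otimes>\<^bsub>G\<^esub> inv\<^bsub>G\<^esub> g \<otimes>\<^bsub>G\<^esub> inv\<^bsub>G\<^esub> (tr a c))
    = (g \<otimes>\<^bsub>G\<^esub> tr a c \<otimes>\<^bsub>G\<^esub> inv\<^bsub>G\<^esub> g) \<otimes>\<^bsub>G\<^esub> tr a c"
    using g t inv_closed[OF g] by (simp only: inv_tr[OF assms(3,4)] m_assoc m_closed)
  also have "\<dots> = tr (g a) (g c) \<otimes>\<^bsub>G\<^esub> tr a c"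
    by (subst conjugate_tr) (use g assms(3,4) in auto)
  finally show ?thesis .
qed

theorem finitely_discriminable_G:
  assumes "infinite S"
  shows "finitely_discriminable G"
proof -
  obtain P where P: "P \<subseteq> S" "finite P" "card P = 4"
    using infinite_arbitrarily_large[OF assms] by blast
  then obtain ps where ps: "set ps = P" "distinct ps" "length ps = 4"
    by (metis distinct_card finite_distinct_list)
  then obtain p q r s where "ps = [p, q, r, s]"
    by (auto simp: numeral_eq_Suc length_Suc_conv)
  then have dist: "distinct [p, q, r, s]" and in_S: "p \<in> S" "q \<in> S" "r \<in> S" "s \<in> S"
    using ps P by auto
  let ?double = "tr p q \<otimes>\<^bsub>G\<^esub> tr r s" and ?cycle = "tr p q \<otimes>\<^bsub>G\<^esub> tr r q"
  have double_closed: "?double \<in> carrier G" and cycle_closed: "?cycle \<in> carrier G"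
    using monoid.m_closed[OF group.is_monoid[OF group_G]] in_S transpose_in by auto
  have "?double p = q" "?cycle p = q"
    using dist in_S by (auto simp: mult_G transpose_in compose_def transpose_def)
  then have nontrivial: "?double \<noteq> \<one>\<^bsub>G\<^esub>" "?cycle \<noteq> \<one>\<^bsub>G\<^esub>"
    using dist in_S by (auto simp: one_G)
  have *: "?double \<in> N \<or> ?cycle \<in> N" if N: "N \<lhd> G" "N \<noteq> {\<one>\<^bsub>G\<^esub>}" for N
  proof -
    have sub: "subgroup N G" using N(1) by (rule normal_imp_subgroup)
    obtain g where g: "g \<in> N" "g \<noteq> \<one>\<^bsub>G\<^esub>"
      using N(2) subgroup.one_closed[OF sub] by blast
    have gH: "g \<in> H" using subgroup.mem_carrier[OF sub g(1)] by simp
    have "g = (\<lambda>x\<in>S. x)" if "\<And>x. x \<in> S \<Longrightarrow> g x = x"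
      using in_Bij[OF gH] that by (intro extensionalityI[of _ S]) (auto simp: Bij_def)
    then obtain a where a: "a \<in> S" "g a \<noteq> a"
      using g(2) unfolding one_G by blast
    obtain a' where a': "a' \<in> S" "g a' = a" using surj_on_S[OF gH a(1)] by blast
    obtain c where c: "c \<in> S" "c \<notin> {a, g a, a'}"
      using assms finite_subset[of S "{a, g a, a'}"] by auto
    have moved: "g a \<in> S" "g c \<in> S" "g c \<noteq> g a" "g c \<noteq> a"
      using a a' c maps_S[OF gH] inj_on_eq_iff[OF inj_on_S[OF gH]] by auto
    have comm: "tr (g a) (g c) \<otimes>\<^bsub>G\<^esub> tr a c \<in> N"
      using commutator_with_tr[OF N(1) g(1) a(1) c(1)] .
    have conj: "tr (h (g a)) (h (g c)) \<otimes>\<^bsub>G\<^esub> tr (h a) (h c) \<in> N" if "h \<in> H" for h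
      using normal.inv_op_closed2[OF N(1) _ comm, of h] that
      by (simp only: conjugate_tr_product[OF that moved(1,2) a(1) c(1)]) simp
    show ?thesis
    proof (cases "g c = c")
      case True
      obtain h where "h \<in> H" "map h [g a, c, a] = [p, q, r]"
        using transitive_on_distinct_lists[of "[g a, c, a]" "[p, q, r]"] dist in_S a c moved
        by auto
      then show ?thesis using conj[of h] True by auto
    next
      case False
      obtain h where "h \<in> H" "map h [g a, g c, a, c] = [p, q, r, s]"
        using transitive_on_distinct_lists[of "[g a, g c, a, c]" "[p, q, r, s]"]
          dist in_S a c moved False by auto
      then show ?thesis using conj[of h] by auto
    qed
  qed
  show ?thesis
    unfolding finitely_discriminable_def
  proof (intro conjI exI[of _ "{?double, ?cycle}"] allI impI)
    show "group G" by (rule group_G)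
    show "{?double, ?cycle} \<subseteq> carrier G - {\<one>\<^bsub>G\<^esub>}"
      using double_closed cycle_closed nontrivial
      by (simp only: insert_subset empty_subsetI Diff_iff singleton_iff simp_thms)
    show "N \<inter> {?double, ?cycle} \<noteq> {}" if "N \<lhd> G \<and> N \<noteq> {\<one>\<^bsub>G\<^esub>}" for N
      using *[OF conjunct1[OF that] conjunct2[OF that]]
      by (simp only: disjoint_iff insert_iff) blast
  qed simp
qed

end

section \<open>Houghton groups\<close>

text \<open>
  The condition is an equation that is solved for \<open>g (x, i)\<close>, so that it can be used for rewriting
  when permutations are composed. For large \<open>x\<close> the truncation in \<^const>\<open>nat\<close> is harmless.
\<close>
definition translates_ends :: "nat \<Rightarrow> (nat \<times> nat \<Rightarrow> nat \<times> nat) \<Rightarrow> (nat \<Rightarrow> int) \<Rightarrow> bool"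
  where "translates_ends n g m \<longleftrightarrow>
    (\<forall>i\<in>{1..n}. \<forall>\<^sub>F x in sequentially. g (x, i) = (nat (int x + m i), i))"

lemma eventually_nat_shift:
  assumes "\<forall>\<^sub>F x in sequentially. P x"
  shows "\<forall>\<^sub>F x in sequentially. P (nat (int x + k))"
proof -
  have "filterlim (\<lambda>x. nat (int x + k)) at_top sequentially"
    unfolding filterlim_at_top
  proof
    fix Z :: nat
    show "\<forall>\<^sub>F x in sequentially. Z \<le> nat (int x + k)"
      using eventually_ge_at_top[of "nat (int Z - k)"] by (rule eventually_mono) auto
  qed
  then show ?thesis using assms by (rule eventually_compose_filterlim[rotated])
qed

lemma eventually_large: "\<forall>\<^sub>F x in sequentially. int x \<ge> k"
  unfolding eventually_sequentially by (rule exI[of _ "nat k"]) auto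

lemma houghton_group_eq:
  "houghton_group n =
    BijGroup (rays n)\<lparr>carrier := {g \<in> Bij (rays n). \<exists>m. translates_ends n g m}\<rparr>"
proof -
  have "(\<forall>\<^sub>F x in sequentially. int (fst (g (x, i))) = int x + m i \<and> snd (g (x, i)) = i)
    \<longleftrightarrow> (\<forall>\<^sub>F x in sequentially. g (x, i) = (nat (int x + m i), i))"
    for g :: "nat \<times> nat \<Rightarrow> nat \<times> nat" and m :: "nat \<Rightarrow> int" and i
    by (rule eventually_cong[OF eventually_large[of "- m i"]]) (auto simp: prod_eq_iff)
  then show ?thesis
    by (simp add: houghton_group_def translates_ends_def)
qed

lemma eventually_in_rays: "i \<in> {1..n} \<Longrightarrow> \<forall>\<^sub>F x in sequentially. (x, i) \<in> rays n"
  using eventually_ge_at_top[of 1] by (auto simp: rays_def elim: eventually_mono)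

lemma translates_ends_compose:
  assumes "translates_ends n g k" "translates_ends n h m"
  shows "translates_ends n (compose (rays n) g h) (\<lambda>i. m i + k i)"
  unfolding translates_ends_def
proof
  fix i assume i: "i \<in> {1..n}"
  have g: "\<forall>\<^sub>F x in sequentially. g (nat (int x + m i), i) = (nat (int (nat (int x + m i)) + k i), i)"
    using assms(1) i eventually_nat_shift[of "\<lambda>x. g (x, i) = (nat (int x + k i), i)" "m i"]
    by (simp add: translates_ends_def)
  have h: "\<forall>\<^sub>F x in sequentially. h (x, i) = (nat (int x + m i), i)"
    using assms(2) i by (simp add: translates_ends_def)
  show "\<forall>\<^sub>F x in sequentially. compose (rays n) g h (x, i) = (nat (int x + (m i + k i)), i)"
    using g h eventually_in_rays[OF i] eventually_large[of "- m i"]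
    by eventually_elim (auto simp: compose_def add.assoc)
qed

lemma translates_ends_inverse:
  assumes "g \<in> Bij (rays n)" "translates_ends n g m"
  shows "translates_ends n (restrict (inv_into (rays n) g) (rays n)) (\<lambda>i. - m i)"
  unfolding translates_ends_def
proof
  fix i assume i: "i \<in> {1..n}"
  let ?y = "\<lambda>x. nat (int x - m i)"
  have g: "\<forall>\<^sub>F x in sequentially. g (?y x, i) = (nat (int (?y x) + m i), i)"
    using assms(2) i eventually_nat_shift[of "\<lambda>x. g (x, i) = (nat (int x + m i), i)" "- m i"]
    by (simp add: translates_ends_def)
  have y: "\<forall>\<^sub>F x in sequentially. (?y x, i) \<in> rays n"
    using eventually_nat_shift[OF eventually_in_rays[OF i], of "- m i"] by simp
  show "\<forall>\<^sub>F x in sequentially.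
      restrict (inv_into (rays n) g) (rays n) (x, i) = (nat (int x + - m i), i)"
    using g y eventually_in_rays[OF i] eventually_large[of "m i"]
  proof eventually_elim
    case (elim x)
    then have "g (?y x, i) = (x, i)" by simp
    moreover have "inj_on g (rays n)" using assms(1) by (simp add: Bij_def bij_betw_def)
    ultimately show ?case using elim inv_into_f_f[of g "rays n" "(?y x, i)"] by simp
  qed
qed

lemma translates_ends_one: "translates_ends n (\<lambda>x\<in>rays n. x) (\<lambda>i. 0)"
  unfolding translates_ends_def
proof
  fix i assume "i \<in> {1..n}"
  then show "\<forall>\<^sub>F x in sequentially. (\<lambda>x\<in>rays n. x) (x, i) = (nat (int x + 0), i)"
    by (rule eventually_mono[OF eventually_in_rays]) simp
qed

lemma translates_ends_transpose:
  "translates_ends n (restrict (transpose a b) (rays n)) (\<lambda>i. 0)"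
  unfolding translates_ends_def
proof
  fix i assume i: "i \<in> {1..n}"
  show "\<forall>\<^sub>F x in sequentially.
      restrict (transpose a b) (rays n) (x, i) = (nat (int x + 0), i)"
    using eventually_in_rays[OF i] eventually_gt_at_top[of "fst a"] eventually_gt_at_top[of "fst b"]
    by eventually_elim (auto simp: transpose_def)
qed

lemma subgroup_houghton:
  "subgroup {g \<in> Bij (rays n). \<exists>m. translates_ends n g m} (BijGroup (rays n))" (is "subgroup ?H _")
proof
  show "?H \<subseteq> carrier (BijGroup (rays n))"
    by (auto simp: BijGroup_def)
  show "\<one>\<^bsub>BijGroup (rays n)\<^esub> \<in> ?H"
    using translates_ends_one id_Bij by (auto simp: BijGroup_def)
  show "g \<otimes>\<^bsub>BijGroup (rays n)\<^esub> h \<in> ?H" if "g \<in> ?H" "h \<in> ?H" for g h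
    using that translates_ends_compose compose_Bij by (fastforce simp: BijGroup_def)
  show "inv\<^bsub>BijGroup (rays n)\<^esub> g \<in> ?H" if "g \<in> ?H" for g
    using that translates_ends_inverse restrict_inv_into_Bij by (fastforce simp: inv_BijGroup)
qed

lemma transpose_in_Bij:
  assumes "a \<in> S" "b \<in> S"
  shows "restrict (transpose a b) S \<in> Bij S"
proof -
  have "bij_betw (transpose a b) S S"
    using assms by (intro bij_betw_byWitness[of _ "transpose a b"]) (auto simp: transpose_def)
  then show ?thesis by (simp add: Bij_def)
qed

theorem proposition5p5:
  fixes n :: nat
  assumes "n \<ge> 1"
  shows "finitely_discriminable (houghton_group n)"
proof -
  interpret group_with_transpositions "rays n" "{g \<in> Bij (rays n). \<exists>m. translates_ends n g m}"
  proof (rule group_with_transpositions.intro)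
    show "subgroup {g \<in> Bij (rays n). \<exists>m. translates_ends n g m} (BijGroup (rays n))"
      by (rule subgroup_houghton)
    show "restrict (transpose a b) (rays n) \<in> {g \<in> Bij (rays n). \<exists>m. translates_ends n g m}"
      if "a \<in> rays n" "b \<in> rays n" for a b
      using transpose_in_Bij[OF that] translates_ends_transpose by blast
  qed
  have "infinite (rays n)"
    using assms by (auto simp: rays_def finite_cartesian_product_iff infinite_Ici)
  then show ?thesis
    unfolding houghton_group_eq by (rule finitely_discriminable_G)
qed

end
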